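(* Consider a bilateral trading network $G=(N,E)$. A competitive equilibrium exists if and only if the linear program $$\mathrm{LP}^{\max}(0):\quad\max\Big\{\sum_{i\in N}\sum_{k=1}^{k_i}v_i(0,x_i^k)\,\alpha_{ik}\;:\;\ell(\alpha)\le0,\ \alpha_i\in\Lambda_i\text{ for all }i\in N\Big\}$$ admits an integral optimal solution $\alpha$ with $\ell(\alpha)=0$.
   Context: Trading network. $G=(N,E)$ is a finite directed multigraph (without loops), $E=\{e_1,\dots,e_m\}$. Vertices are players; an edge $e=(s,b)$ is a possible trade with seller $s$ and buyer $b$. $\delta^+(i),\delta^-(i)$ denote the outgoing and incoming edges of $i$, $\delta(i)=\delta^+(i)\cup\delta^-(i)$. Player $i$ has $\bar w_i:2^{\delta(i)}\to\mathbb{R}$, extended to $w_i:2^E\to\mathbb{R}$, $w_i(S)=\bar w_i(S\cap\delta(i))$; it is assumed that $w_i(S)\ge w_i(T)$ for all $T\subseteq S\subseteq\delta^-(i)$. A competitive equilibrium is a pair $(S^*,\lambda)$ with $S^*\subseteq E$, $\lambda\in\mathbb{R}^m_+$ such that for all $i\in N$ $$S^*\in\arg\max_{S\subseteq E}\Big\{w_i(S)+\sum_{e\in\delta^+(i)\cap S}\lambda_e-\sum_{e\in\delta^-(i)\cap S}\lambda_e\Big\}.$$ LP data. For $i\in N$, $X_i$ is the set of vectors $x_i\in\{-1,0,1\}^m$ with $x_{ie}\in\{-1,0\}$ for $e\in\delta^+(i)$ ($-1$: trade realized as seller), $x_{ie}\in\{0,1\}$ for $e\in\delta^-(i)$ ($1$: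 trade realized as buyer), and $x_{ie}=0$ for $e\notin\delta(i)$. Write $X_i=\{x_i^1,\dots,x_i^{k_i}\}$, $v_i(0,x_i)=w_i(\{e\in\delta(i):|x_{ie}|=1\})$, $\Lambda_i=\{\alpha_i\in\mathbb{R}^{k_i}_+:\sum_k\alpha_{ik}=1\}$, and $\ell(\alpha)=\sum_{i\in N}\sum_{k=1}^{k_i}\alpha_{ik}x_i^k\in\mathbb{R}^m$. *)

theory Defs
  imports Complex_Main "Graph_Theory.Digraph"
begin

text \<open>
  A trade is an arc \<open>e\<close> of a loop-free directed multigraph, with seller \<open>tail G e\<close> and buyer
  \<open>head G e\<close>. Hence \<open>out_arcs G i\<close> are the trades sold by player \<open>i\<close> and \<open>in_arcs G i\<close> the
  trades bought by \<open>i\<close>.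
\<close>

definition incident_arcs :: "('a, 'b) pre_digraph \<Rightarrow> 'a \<Rightarrow> 'b set" where
  "incident_arcs G i = out_arcs G i \<union> in_arcs G i"

text \<open>
  \<open>wbar i\<close> is only ever evaluated on subsets of \<open>incident_arcs G i\<close>; its values elsewhere are
  irrelevant.
\<close>

definition valuation ::
  "('a, 'b) pre_digraph \<Rightarrow> ('a \<Rightarrow> 'b set \<Rightarrow> real) \<Rightarrow> 'a \<Rightarrow> 'b set \<Rightarrow> real" where
  "valuation G wbar i S = wbar i (S \<inter> incident_arcs G i)"

locale trading_network = fin_digraph G + loopfree_digraph G
  for G :: "('a, 'b) pre_digraph" +
  fixes wbar :: "'a \<Rightarrow> 'b set \<Rightarrow> real"
  assumes valuation_mono:
    "\<lbrakk>i \<in> verts G; T \<subseteq> S; S \<subseteq> in_arcs G i\<rbrakk> \<Longrightarrow> valuation G wbar i T \<le> valuation G wbar i S"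

definition utility ::
  "('a, 'b) pre_digraph \<Rightarrow> ('a \<Rightarrow> 'b set \<Rightarrow> real) \<Rightarrow> ('b \<Rightarrow> real) \<Rightarrow> 'a \<Rightarrow> 'b set \<Rightarrow> real" where
  "utility G wbar p i S =
     valuation G wbar i S + (\<Sum>e\<in>out_arcs G i \<inter> S. p e) - (\<Sum>e\<in>in_arcs G i \<inter> S. p e)"

definition competitive_equilibrium ::
  "('a, 'b) pre_digraph \<Rightarrow> ('a \<Rightarrow> 'b set \<Rightarrow> real) \<Rightarrow> 'b set \<Rightarrow> ('b \<Rightarrow> real) \<Rightarrow> bool" where
  "competitive_equilibrium G wbar S p \<longleftrightarrow>
     S \<subseteq> arcs G \<and> (\<forall>e\<in>arcs G. 0 \<le> p e) \<and>
     (\<forall>i\<in>verts G. is_arg_max (utility G wbar p i) (\<lambda>T. T \<subseteq> arcs G) S)"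

text \<open>
  Vectors indexed by the trades are functions on the arc type. The last condition below also
  forces the value 0 outside \<open>arcs G\<close>, so that each vector has exactly one representation.
\<close>

definition trade_vectors :: "('a, 'b) pre_digraph \<Rightarrow> 'a \<Rightarrow> ('b \<Rightarrow> real) set" where
  "trade_vectors G i =
     {x. (\<forall>e\<in>out_arcs G i. x e \<in> {-1, 0}) \<and> (\<forall>e\<in>in_arcs G i. x e \<in> {0, 1}) \<and>
         (\<forall>e. e \<notin> incident_arcs G i \<longrightarrow> x e = 0)}"

lemma (in fin_digraph) finite_trade_vectors: "finite (trade_vectors G i)"
proof (rule finite_subset)
  have "finite (incident_arcs G i)"
    by (simp add: incident_arcs_def in_arcs_def out_arcs_def)
  then show "finite {x. \<forall>e. (e \<in> incident_arcs G i \<longrightarrow> x e \<in> {-1, 0, 1 :: real}) \<and>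
                            (e \<notin> incident_arcs G i \<longrightarrow> x e = 0)}"
    by (intro finite_set_of_finite_funs) simp_all
  show "trade_vectors G i \<subseteq> {x. \<forall>e. (e \<in> incident_arcs G i \<longrightarrow> x e \<in> {-1, 0, 1 :: real}) \<and>
                            (e \<notin> incident_arcs G i \<longrightarrow> x e = 0)}"
    by (auto simp: trade_vectors_def incident_arcs_def)
qed

definition trade_value ::
  "('a, 'b) pre_digraph \<Rightarrow> ('a \<Rightarrow> 'b set \<Rightarrow> real) \<Rightarrow> 'a \<Rightarrow> ('b \<Rightarrow> real) \<Rightarrow> real" where
  "trade_value G wbar i x = valuation G wbar i {e \<in> incident_arcs G i. \<bar>x e\<bar> = 1}"

text \<open>
  Instead of numbering the elements of \<open>trade_vectors G i\<close>, the LP variables are indexed by these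
  vectors themselves: \<open>\<alpha> i x\<close> is the weight that player \<open>i\<close> puts on \<open>x\<close>. Values of \<open>\<alpha> i x\<close> with
  \<open>i \<notin> verts G\<close> or \<open>x \<notin> trade_vectors G i\<close> are not LP variables and are irrelevant.
\<close>

definition weights :: "('a, 'b) pre_digraph \<Rightarrow> 'a \<Rightarrow> (('b \<Rightarrow> real) \<Rightarrow> real) set" where
  "weights G i = {a. (\<forall>x\<in>trade_vectors G i. 0 \<le> a x) \<and> (\<Sum>x\<in>trade_vectors G i. a x) = 1}"

definition excess ::
  "('a, 'b) pre_digraph \<Rightarrow> ('a \<Rightarrow> ('b \<Rightarrow> real) \<Rightarrow> real) \<Rightarrow> 'b \<Rightarrow> real" where
  "excess G \<alpha> e = (\<Sum>i\<in>verts G. \<Sum>x\<in>trade_vectors G i. \<alpha> i x * x e)"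

definition lp_feasible ::
  "('a, 'b) pre_digraph \<Rightarrow> ('a \<Rightarrow> ('b \<Rightarrow> real) \<Rightarrow> real) \<Rightarrow> bool" where
  "lp_feasible G \<alpha> \<longleftrightarrow>
     (\<forall>e\<in>arcs G. excess G \<alpha> e \<le> 0) \<and> (\<forall>i\<in>verts G. \<alpha> i \<in> weights G i)"

definition lp_objective ::
  "('a, 'b) pre_digraph \<Rightarrow> ('a \<Rightarrow> 'b set \<Rightarrow> real) \<Rightarrow> ('a \<Rightarrow> ('b \<Rightarrow> real) \<Rightarrow> real) \<Rightarrow> real" where
  "lp_objective G wbar \<alpha> =
     (\<Sum>i\<in>verts G. \<Sum>x\<in>trade_vectors G i. trade_value G wbar i x * \<alpha> i x)"

definition lp_optimal ::
  "('a, 'b) pre_digraph \<Rightarrow> ('a \<Rightarrow> 'b set \<Rightarrow> real) \<Rightarrow> ('a \<Rightarrow> ('b \<Rightarrow> real) \<Rightarrow> real) \<Rightarrow> bool" where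
  "lp_optimal G wbar \<alpha> \<longleftrightarrow> is_arg_max (lp_objective G wbar) (lp_feasible G) \<alpha>"

definition integral_weights ::
  "('a, 'b) pre_digraph \<Rightarrow> ('a \<Rightarrow> ('b \<Rightarrow> real) \<Rightarrow> real) \<Rightarrow> bool" where
  "integral_weights G \<alpha> \<longleftrightarrow> (\<forall>i\<in>verts G. \<forall>x\<in>trade_vectors G i. \<alpha> i x \<in> \<int>)"

end

theory Submission
  imports Defs
begin

text \<open>
  Prices of an equilibrium are dual variables for the constraint \<open>\<ell>(\<alpha>) \<le> 0\<close>: a set of trades
  is encoded by one vector per player, and the utility at prices \<open>p\<close> is the value minus
  \<open>p \<bullet> x\<close>. Weak duality shows that an equilibrium yields an optimal integral solution. Conversely,
  if no nonnegative prices support an integral solution without excess, then Farkas' lemma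
  provides nonnegative weights for the deviations of the players; moving from the solution by a
  small multiple of these deviations keeps it feasible and raises the objective.
\<close>

section \<open>Systems of linear inequalities and Farkas' lemma\<close>

lemma exists_real_between_finite_sets:
  fixes A B :: "real set"
  assumes "finite A" "finite B" "\<And>a b. a \<in> A \<Longrightarrow> b \<in> B \<Longrightarrow> a \<le> b"
  shows "\<exists>t. (\<forall>a\<in>A. a \<le> t) \<and> (\<forall>b\<in>B. t \<le> b)"
proof (cases "A = {}")
  case True
  then show ?thesis using assms(2) by (cases "B = {}") (auto intro!: exI[of _ "Min B"])
next
  case False
  then show ?thesis using assms by (intro exI[of _ "Max A"]) auto
qed

text \<open>
  Fourier--Motzkin elimination of the coordinates in \<open>E\<close>. The row \<open>(a, c)\<close> stands for the
  inequality \<open>c \<le> p \<bullet> a\<close>. Taking an arbitrary convex cone \<open>K\<close> around the rows keeps the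
  induction free of multipliers.
\<close>

lemma farkas_cone:
  fixes K :: "(('b \<Rightarrow> real) \<times> real) set"
  assumes "finite E" and "finite R" and "R \<subseteq> K"
    and "\<And>a c b d. (a, c) \<in> K \<Longrightarrow> (b, d) \<in> K \<Longrightarrow> (\<lambda>e. a e + b e, c + d) \<in> K"
    and "\<And>a c t. (a, c) \<in> K \<Longrightarrow> 0 < t \<Longrightarrow> (\<lambda>e. t * a e, t * c) \<in> K"
  shows "(\<exists>p. \<forall>(a, c)\<in>R. c \<le> (\<Sum>e\<in>E. p e * a e)) \<or>
         (\<exists>(a, c)\<in>K. (\<forall>e\<in>E. a e = 0) \<and> 0 < c)"
  using assms
proof (induction E arbitrary: R K rule: finite_induct)
  case empty
  \<comment> \<open>With no coordinates left a row just reads \<open>c \<le> 0\<close>, so a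
    violated row of \<open>R\<close>, being in \<open>K\<close>, is itself the certificate.\<close>
  then show ?case by (fastforce simp: not_le)
next
  case (insert e0 E)
  note add = insert.prems(3) and scale = insert.prems(4)
  \<comment> \<open>For a row of \<open>Pos\<close> and a row of \<open>Neg\<close> both multipliers
    \<open>a e0\<close> and \<open>- b e0\<close> are positive, and they are chosen so that the
    entries at \<open>e0\<close> cancel.\<close>
  define comb :: "('b \<Rightarrow> real) \<times> real \<Rightarrow> ('b \<Rightarrow> real) \<times> real \<Rightarrow> ('b \<Rightarrow> real) \<times> real"
    where "comb = (\<lambda>(a, c) (b, d). (\<lambda>e. - b e0 * a e + a e0 * b e, - b e0 * c + a e0 * d))"
  define Pos where "Pos = {r \<in> R. 0 < fst r e0}"
  define Neg where "Neg = {r \<in> R. fst r e0 < 0}"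
  define R' where "R' = {r \<in> R. fst r e0 = 0} \<union> (\<lambda>(r, s). comb r s) ` (Pos \<times> Neg)"
  \<comment> \<open>This slice of the cone is again closed under sums and positive multiples, and a
    certificate found in it for \<open>E\<close> already vanishes at \<open>e0\<close>, so it serves
    for \<open>insert e0 E\<close> unchanged.\<close>
  define K' where "K' = {r \<in> K. fst r e0 = 0}"
  have fin: "finite Pos" "finite Neg"
    using insert.prems by (auto simp: Pos_def Neg_def)
  have "comb r s \<in> K'" if "r \<in> Pos" "s \<in> Neg" for r s
  proof -
    obtain a c b d where rs: "r = (a, c)" "s = (b, d)" by fastforce
    have "(a, c) \<in> K" "(b, d) \<in> K" "0 < - b e0" "0 < a e0"
      using that insert.prems rs by (auto simp: Pos_def Neg_def)
    from add[OF scale[OF this(1,3)] scale[OF this(2,4)]] show ?thesis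
      by (simp add: comb_def rs K'_def)
  qed
  then have "R' \<subseteq> K'"
    using insert.prems by (auto simp: R'_def K'_def)
  moreover have "finite R'"
    using insert.prems fin by (auto simp: R'_def)
  ultimately consider
      p where "\<forall>(a, c)\<in>R'. c \<le> (\<Sum>e\<in>E. p e * a e)"
    | a c where "(a, c) \<in> K'" "\<forall>e\<in>E. a e = 0" "0 < c"
    using insert.IH[of R' K'] add scale by (fastforce simp: K'_def)
  then show ?case
  proof cases
    case 1
    \<comment> \<open>With \<open>p\<close> fixed on \<open>E\<close>, this is the value of
      coordinate \<open>e0\<close> that makes the row \<open>r\<close> tight: a lower bound on it
      for rows in \<open>Pos\<close>, an upper bound for rows in \<open>Neg\<close>. The combined
      rows say exactly that these bounds are compatible.\<close>
    define bound where "bound r = (snd r - (\<Sum>e\<in>E. p e * fst r e)) / fst r e0"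
      for r :: "('b \<Rightarrow> real) \<times> real"
    have "bound r \<le> bound s" if "r \<in> Pos" "s \<in> Neg" for r s
    proof -
      obtain a c b d where rs: "r = (a, c)" "s = (b, d)" by fastforce
      have "comb r s \<in> R'"
        using that by (auto simp: R'_def)
      with 1 have "- b e0 * c + a e0 * d \<le> (\<Sum>e\<in>E. p e * (- b e0 * a e + a e0 * b e))"
        by (auto simp: comb_def rs)
      also have "\<dots> = - b e0 * (\<Sum>e\<in>E. p e * a e) + a e0 * (\<Sum>e\<in>E. p e * b e)"
        by (simp add: sum_distrib_left sum.distrib[symmetric] algebra_simps)
      finally show ?thesis
        using that by (simp add: bound_def rs Pos_def Neg_def field_simps)
    qed
    then obtain t where t: "\<forall>r\<in>Pos. bound r \<le> t" "\<forall>r\<in>Neg. t \<le> bound r"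
      using exists_real_between_finite_sets[of "bound ` Pos" "bound ` Neg"] fin by fast
    have "c \<le> t * a e0 + (\<Sum>e\<in>E. p e * a e)" if r: "(a, c) \<in> R" for a c
    proof (cases "a e0" "0 :: real" rule: linorder_cases)
      case less
      then have "t \<le> bound (a, c)" using t r by (auto simp: Neg_def)
      with less show ?thesis by (simp add: bound_def field_simps)
    next
      case equal
      then show ?thesis using 1 r by (fastforce simp: R'_def)
    next
      case greater
      then have "bound (a, c) \<le> t" using t r by (auto simp: Pos_def)
      with greater show ?thesis by (simp add: bound_def field_simps)
    qed
    moreover have "(\<Sum>e\<in>E. (p(e0 := t)) e * a e) = (\<Sum>e\<in>E. p e * a e)" for a
      using insert.hyps by (intro sum.cong) auto
    ultimately have "\<forall>(a, c)\<in>R. c \<le> (\<Sum>e\<in>insert e0 E. (p(e0 := t)) e * a e)"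
      using insert.hyps by auto
    then show ?thesis by blast
  next
    case 2
    then show ?thesis by (auto simp: K'_def)
  qed
qed

text \<open>A nonzero nonnegative integer is at least 1 and thus exhausts the total, leaving 0 for
  all other points: the integral points of a simplex are its vertices.\<close>

lemma integral_weights_concentrated:
  fixes a :: "'c \<Rightarrow> real"
  assumes "finite A" and nonneg: "\<And>x. x \<in> A \<Longrightarrow> 0 \<le> a x" and total: "sum a A = 1"
    and integral: "\<And>x. x \<in> A \<Longrightarrow> a x \<in> \<int>"
  shows "\<exists>y\<in>A. \<forall>x\<in>A. a x = of_bool (x = y)"
proof -
  obtain y where y: "y \<in> A" "a y \<noteq> 0"
    using total by (metis sum.neutral zero_neq_one)
  have "1 \<le> a y"
    using Ints_nonzero_abs_ge1[OF integral[OF y(1)] y(2)] nonneg[OF y(1)] by simp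
  moreover have split: "a y + sum a (A - {y}) = 1"
    using sum.remove[OF \<open>finite A\<close> y(1), of a] total by simp
  moreover have "0 \<le> sum a (A - {y})"
    using nonneg by (intro sum_nonneg) auto
  ultimately have "sum a (A - {y}) = 0" by linarith
  moreover from this split have "a y = 1" by simp
  ultimately have "\<forall>x\<in>A. a x = of_bool (x = y)"
    using sum_nonneg_eq_0_iff[of "A - {y}" a] nonneg \<open>finite A\<close> by auto
  then show ?thesis using y(1) by blast
qed

section \<open>Encoding sets of trades as vectors\<close>

definition trade_vector :: "('a, 'b) pre_digraph \<Rightarrow> 'a \<Rightarrow> 'b set \<Rightarrow> 'b \<Rightarrow> real" where
  "trade_vector G i S e =
     (if e \<in> out_arcs G i \<inter> S then -1 else if e \<in> in_arcs G i \<inter> S then 1 else 0)"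

context trading_network
begin

lemma out_in_arcs_disjoint: "e \<in> out_arcs G i \<Longrightarrow> e \<notin> in_arcs G i"
  using no_loops by fastforce

lemma trade_vector_in_trade_vectors: "trade_vector G i S \<in> trade_vectors G i"
  using out_in_arcs_disjoint[of _ i]
  by (auto simp: trade_vectors_def trade_vector_def incident_arcs_def)

text \<open>The support of a vector is a set of trades that encodes to it, since each sign is forced
  by the player's role in the trade. Maximizing over sets of trades thus amounts to maximizing over
  vectors.\<close>

lemma trade_vectors_eq_image: "trade_vectors G i = trade_vector G i ` Pow (arcs G)"
proof
  show "trade_vectors G i \<subseteq> trade_vector G i ` Pow (arcs G)"
  proof
    fix x assume x: "x \<in> trade_vectors G i"
    have "x = trade_vector G i {e \<in> arcs G. x e \<noteq> 0}"
      using x out_in_arcs_disjoint[of _ i]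
      by (auto simp: trade_vector_def trade_vectors_def incident_arcs_def fun_eq_iff)
    then show "x \<in> trade_vector G i ` Pow (arcs G)" by blast
  qed
qed (auto simp: trade_vector_in_trade_vectors)

lemma trade_value_trade_vector:
  "trade_value G wbar i (trade_vector G i S) = valuation G wbar i S"
proof -
  have "{e \<in> incident_arcs G i. \<bar>trade_vector G i S e\<bar> = 1} = S \<inter> incident_arcs G i"
    by (auto simp: trade_vector_def incident_arcs_def)
  then show ?thesis
    by (simp add: trade_value_def valuation_def Int_assoc)
qed

text \<open>With -1 for sales and 1 for purchases, the product of \<open>p\<close> with the vector
  is the player's net payment.\<close>

lemma utility_eq_trade_vector:
  "utility G wbar p i S =
     trade_value G wbar i (trade_vector G i S) - (\<Sum>e\<in>arcs G. p e * trade_vector G i S e)"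
proof -
  have "p e * trade_vector G i S e =
      (if e \<in> in_arcs G i \<inter> S then p e else 0) - (if e \<in> out_arcs G i \<inter> S then p e else 0)" for e
    using out_in_arcs_disjoint[of e i] by (auto simp: trade_vector_def)
  moreover have "arcs G \<inter> (in_arcs G i \<inter> S) = in_arcs G i \<inter> S"
    "arcs G \<inter> (out_arcs G i \<inter> S) = out_arcs G i \<inter> S"
    by auto
  ultimately have "(\<Sum>e\<in>arcs G. p e * trade_vector G i S e) =
      (\<Sum>e\<in>in_arcs G i \<inter> S. p e) - (\<Sum>e\<in>out_arcs G i \<inter> S. p e)"
    by (simp only: sum_subtractf sum.inter_restrict[OF finite_arcs, symmetric])
  then show ?thesis
    by (simp add: utility_def trade_value_trade_vector)
qed

lemma sum_over_endpoints:
  fixes f :: "'a \<Rightarrow> real"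
  assumes "e \<in> arcs G" "\<And>i. i \<in> verts G \<Longrightarrow> i \<noteq> tail G e \<Longrightarrow> i \<noteq> head G e \<Longrightarrow> f i = 0"
  shows "(\<Sum>i\<in>verts G. f i) = f (tail G e) + f (head G e)"
proof -
  have "(\<Sum>i\<in>verts G. f i) = (\<Sum>i\<in>{tail G e, head G e}. f i)"
    using assms by (intro sum.mono_neutral_right) auto
  then show ?thesis
    using assms(1) no_loops by simp
qed

text \<open>The seller's -1 and the buyer's 1 cancel. Markets clear as soon as all players encode
  the same set of trades.\<close>

lemma sum_trade_vector_eq_0:
  assumes "e \<in> arcs G"
  shows "(\<Sum>i\<in>verts G. trade_vector G i S e) = 0"
  using assms no_loops[OF assms]
  by (subst sum_over_endpoints[OF assms]) (auto simp: trade_vector_def)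

section \<open>Lagrangian of the LP and weak duality\<close>

text \<open>Once the coupling constraints are priced, the problem separates into one weighted sum of
  net utilities per player.\<close>

lemma lp_lagrangian:
  "lp_objective G wbar \<alpha> - (\<Sum>e\<in>arcs G. p e * excess G \<alpha> e) =
     (\<Sum>i\<in>verts G. \<Sum>x\<in>trade_vectors G i.
        \<alpha> i x * (trade_value G wbar i x - (\<Sum>e\<in>arcs G. p e * x e)))"
proof -
  have "(\<Sum>e\<in>arcs G. p e * excess G \<alpha> e) =
      (\<Sum>e\<in>arcs G. \<Sum>i\<in>verts G. \<Sum>x\<in>trade_vectors G i. \<alpha> i x * (p e * x e))"
    by (simp add: excess_def sum_distrib_left algebra_simps)
  also have "\<dots> = (\<Sum>i\<in>verts G. \<Sum>e\<in>arcs G. \<Sum>x\<in>trade_vectors G i. \<alpha> i x * (p e * x e))"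
    by (rule sum.swap)
  also have "\<dots> = (\<Sum>i\<in>verts G. \<Sum>x\<in>trade_vectors G i. \<Sum>e\<in>arcs G. \<alpha> i x * (p e * x e))"
    by (intro sum.cong refl sum.swap)
  finally show ?thesis
    by (simp add: lp_objective_def sum_distrib_left sum_subtractf right_diff_distrib mult.commute)
qed

text \<open>Here \<open>p\<close> and \<open>u\<close> form a dual solution. For feasible
  \<open>\<beta>\<close>, nonnegative prices on nonpositive excess can only raise the Lagrangian
  above the objective, and since weights sum to 1, each player's part of the Lagrangian is at most
  \<open>u i\<close>.\<close>

lemma lp_optimal_of_supporting_prices:
  assumes feasible: "lp_feasible G \<alpha>"
    and no_excess: "\<forall>e\<in>arcs G. excess G \<alpha> e = 0"
    and nonneg: "\<forall>e\<in>arcs G. 0 \<le> p e"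
    and objective: "lp_objective G wbar \<alpha> = (\<Sum>i\<in>verts G. u i)"
    and support: "\<And>i x. i \<in> verts G \<Longrightarrow> x \<in> trade_vectors G i \<Longrightarrow>
      trade_value G wbar i x - (\<Sum>e\<in>arcs G. p e * x e) \<le> u i"
  shows "lp_optimal G wbar \<alpha>"
proof -
  have "lp_objective G wbar \<beta> \<le> lp_objective G wbar \<alpha>" if "lp_feasible G \<beta>" for \<beta>
  proof -
    have "(\<Sum>e\<in>arcs G. p e * excess G \<beta> e) \<le> 0"
      using that nonneg by (intro sum_nonpos) (auto simp: lp_feasible_def mult_nonneg_nonpos)
    then have "lp_objective G wbar \<beta> \<le>
        lp_objective G wbar \<beta> - (\<Sum>e\<in>arcs G. p e * excess G \<beta> e)"
      by simp
    also have "\<dots> \<le> (\<Sum>i\<in>verts G. \<Sum>x\<in>trade_vectors G i. \<beta> i x * u i)"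
      unfolding lp_lagrangian using that support
      by (intro sum_mono mult_left_mono) (auto simp: lp_feasible_def weights_def)
    also have "\<dots> = (\<Sum>i\<in>verts G. u i)"
      using that by (simp add: lp_feasible_def weights_def sum_distrib_right[symmetric])
    finally show ?thesis using objective by simp
  qed
  then show ?thesis
    using feasible by (auto simp: lp_optimal_def is_arg_max_linorder)
qed

section \<open>Point weights, and integral solutions from equilibria\<close>

lemma sum_point_weight:
  assumes "y \<in> trade_vectors G i"
  shows "(\<Sum>x\<in>trade_vectors G i. of_bool (x = y) * f x) = (f y :: real)"
proof -
  have "(\<Sum>x\<in>trade_vectors G i. of_bool (x = y) * f x) =
      (\<Sum>x\<in>trade_vectors G i. if x = y then f x else 0)"
    by (intro sum.cong) auto
  then show ?thesis
    using assms by (simp add: finite_trade_vectors)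
qed

lemma excess_point_weights:
  assumes "\<And>i. i \<in> verts G \<Longrightarrow> \<xi> i \<in> trade_vectors G i"
  shows "excess G (\<lambda>i x. of_bool (x = \<xi> i)) e = (\<Sum>i\<in>verts G. \<xi> i e)"
  using assms by (simp add: excess_def sum_point_weight[where f = "\<lambda>x. x e"])

lemma lp_objective_point_weights:
  assumes "\<And>i. i \<in> verts G \<Longrightarrow> \<xi> i \<in> trade_vectors G i"
  shows "lp_objective G wbar (\<lambda>i x. of_bool (x = \<xi> i)) =
    (\<Sum>i\<in>verts G. trade_value G wbar i (\<xi> i))"
  using assms
  by (simp add: lp_objective_def sum_point_weight mult.commute[of _ "of_bool _"])

lemma point_weights_in_weights:
  assumes "y \<in> trade_vectors G i"
  shows "(\<lambda>x. of_bool (x = y)) \<in> weights G i"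
  using sum_point_weight[OF assms, of "\<lambda>_. 1"] by (simp add: weights_def)

lemma integral_solution_of_equilibrium:
  assumes "competitive_equilibrium G wbar S p"
  shows "\<exists>\<alpha>. lp_optimal G wbar \<alpha> \<and> integral_weights G \<alpha> \<and> (\<forall>e\<in>arcs G. excess G \<alpha> e = 0)"
proof -
  let ?\<xi> = "\<lambda>i. trade_vector G i S"
  let ?\<alpha> = "\<lambda>i x. of_bool (x = ?\<xi> i) :: real"
  have no_excess: "\<forall>e\<in>arcs G. excess G ?\<alpha> e = 0"
    by (simp add: excess_point_weights trade_vector_in_trade_vectors sum_trade_vector_eq_0)
  have "lp_feasible G ?\<alpha>"
    by (simp add: lp_feasible_def no_excess point_weights_in_weights trade_vector_in_trade_vectors)
  \<comment> \<open>Without excess the payments cancel in total, so the Lagrangian equals the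
    objective.\<close>
  moreover have "lp_objective G wbar ?\<alpha> = (\<Sum>i\<in>verts G. utility G wbar p i S)"
    using lp_lagrangian[of ?\<alpha> p] no_excess
    by (simp add: sum_point_weight trade_vector_in_trade_vectors utility_eq_trade_vector)
  moreover have "trade_value G wbar i x - (\<Sum>e\<in>arcs G. p e * x e) \<le> utility G wbar p i S"
    if "i \<in> verts G" "x \<in> trade_vectors G i" for i x
  proof -
    have "\<exists>T\<subseteq>arcs G. x = trade_vector G i T"
      using trade_vectors_eq_image that by auto
    then show ?thesis
      using assms that(1)
      by (auto simp: competitive_equilibrium_def is_arg_max_linorder utility_eq_trade_vector)
  qed
  ultimately have "lp_optimal G wbar ?\<alpha>"
    using assms no_excess
      lp_optimal_of_supporting_prices[of ?\<alpha> p "\<lambda>i. utility G wbar p i S"]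
    by (auto simp: competitive_equilibrium_def)
  then show ?thesis
    using no_excess by (auto simp: integral_weights_def)
qed

section \<open>Supporting prices from Farkas' lemma\<close>

text \<open>This is strong duality at a solution given by one vector per player. The prices come out
  nonnegative because the LP also admits negative excess.\<close>

lemma supporting_prices:
  assumes \<xi>: "\<And>i. i \<in> verts G \<Longrightarrow> \<xi> i \<in> trade_vectors G i"
    and no_excess: "\<And>e. e \<in> arcs G \<Longrightarrow> (\<Sum>i\<in>verts G. \<xi> i e) = 0"
    and optimal: "\<And>\<alpha>. lp_feasible G \<alpha> \<Longrightarrow>
      lp_objective G wbar \<alpha> \<le> (\<Sum>i\<in>verts G. trade_value G wbar i (\<xi> i))"
  obtains p where "\<And>e. e \<in> arcs G \<Longrightarrow> 0 \<le> p e"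
    and "\<And>i x. i \<in> verts G \<Longrightarrow> x \<in> trade_vectors G i \<Longrightarrow>
      trade_value G wbar i x - (\<Sum>e\<in>arcs G. p e * x e) \<le>
      trade_value G wbar i (\<xi> i) - (\<Sum>e\<in>arcs G. p e * \<xi> i e)"
proof -
  define v where "v = trade_value G wbar"
  \<comment> \<open>The change in the total of \<open>f\<close> when the players deviate from
    \<open>\<xi>\<close> with weights \<open>\<beta>\<close>. It is used for the values
    \<open>v\<close> and, with \<open>f\<close> the entry at \<open>e\<close>, for the excess of
    trade \<open>e\<close>.\<close>
  define gain :: "('a \<Rightarrow> ('b \<Rightarrow> real) \<Rightarrow> real) \<Rightarrow> ('a \<Rightarrow> ('b \<Rightarrow> real) \<Rightarrow> real) \<Rightarrow> real"
    where "gain f \<beta> =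
      (\<Sum>i\<in>verts G. \<Sum>x\<in>trade_vectors G i. \<beta> i x * (f i x - f i (\<xi> i)))" for f \<beta>
  have gain_add: "gain f (\<lambda>i x. \<beta> i x + \<gamma> i x) = gain f \<beta> + gain f \<gamma>" for f \<beta> \<gamma>
    by (simp add: gain_def distrib_right sum.distrib)
  have gain_scale: "gain f (\<lambda>i x. t * \<beta> i x) = t * gain f \<beta>" for f t \<beta>
    by (simp add: gain_def sum_distrib_left mult.assoc)
  have gain_single: "gain f (\<lambda>j y. of_bool (j = i \<and> y = x)) = f i x - f i (\<xi> i)"
    if "i \<in> verts G" "x \<in> trade_vectors G i" for f i x
  proof -
    have "gain f (\<lambda>j y. of_bool (j = i \<and> y = x)) =
        (\<Sum>j\<in>verts G. if j = i then f i x - f i (\<xi> i) else 0)"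
      unfolding gain_def
      using that(2) by (intro sum.cong refl) (auto simp: sum_point_weight)
    then show ?thesis using that(1) by simp
  qed
  define nonneg :: "('a \<Rightarrow> ('b \<Rightarrow> real) \<Rightarrow> real) \<Rightarrow> bool"
    where "nonneg \<beta> \<longleftrightarrow> (\<forall>i\<in>verts G. \<forall>x\<in>trade_vectors G i. 0 \<le> \<beta> i x)" for \<beta>
  \<comment> \<open>The inequality in place of an equality absorbs nonnegative multiples of the unit
    rows that express \<open>0 \<le> p e\<close>. Their right-hand side is 0, so the second
    component stays an equality, and \<open>\<beta>\<close> is the only multiplier to track.\<close>
  define K where "K = {(a, c). \<exists>\<beta>. nonneg \<beta> \<and> c = gain v \<beta> \<and>
    (\<forall>e\<in>arcs G. gain (\<lambda>i x. x e) \<beta> \<le> a e)}"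
  \<comment> \<open>The first family says that \<open>\<xi> i\<close> maximizes net utility at
    \<open>p\<close>, the second that \<open>p\<close> is nonnegative on the trades.\<close>
  define R where "R =
    (\<lambda>(i, x). (\<lambda>e. x e - \<xi> i e, v i x - v i (\<xi> i))) ` (SIGMA i:verts G. trade_vectors G i) \<union>
    (\<lambda>e'. (\<lambda>e. of_bool (e = e'), 0)) ` arcs G"
  have "finite R"
    by (auto simp: R_def finite_trade_vectors)
  moreover have "R \<subseteq> K"
  proof -
    have "(\<lambda>e. x e - \<xi> i e, v i x - v i (\<xi> i)) \<in> K"
      if "i \<in> verts G" "x \<in> trade_vectors G i" for i x
      using that by (auto simp: K_def nonneg_def gain_single
          intro!: exI[of _ "\<lambda>j y. of_bool (j = i \<and> y = x)"])
    moreover have "(\<lambda>e. of_bool (e = e'), 0) \<in> K" for e'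
      by (auto simp: K_def nonneg_def gain_def intro!: exI[of _ "\<lambda>j y. 0"])
    ultimately show ?thesis by (auto simp: R_def)
  qed
  moreover have "(\<lambda>e. a e + b e, c + d) \<in> K" if mem: "(a, c) \<in> K" "(b, d) \<in> K" for a c b d
  proof -
    obtain \<beta> where "nonneg \<beta>" "c = gain v \<beta>" "\<forall>e\<in>arcs G. gain (\<lambda>i x. x e) \<beta> \<le> a e"
      using mem by (auto simp: K_def)
    moreover obtain \<gamma> where "nonneg \<gamma>" "d = gain v \<gamma>" "\<forall>e\<in>arcs G. gain (\<lambda>i x. x e) \<gamma> \<le> b e"
      using mem by (auto simp: K_def)
    ultimately show ?thesis
      by (auto simp: K_def nonneg_def gain_add add_mono
          intro!: exI[of _ "\<lambda>i x. \<beta> i x + \<gamma> i x"])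
  qed
  moreover have "(\<lambda>e. t * a e, t * c) \<in> K" if mem: "(a, c) \<in> K" and "0 < t" for a c t
  proof -
    obtain \<beta> where "nonneg \<beta>" "c = gain v \<beta>" "\<forall>e\<in>arcs G. gain (\<lambda>i x. x e) \<beta> \<le> a e"
      using mem by (auto simp: K_def)
    with \<open>0 < t\<close> show ?thesis
      by (auto simp: K_def nonneg_def gain_scale intro!: exI[of _ "\<lambda>i x. t * \<beta> i x"])
  qed
  moreover have False if mem: "(a, c) \<in> K" "\<forall>e\<in>arcs G. a e = 0" "0 < c" for a c
  proof -
    obtain \<beta> where \<beta>: "nonneg \<beta>" "0 < gain v \<beta>" "\<And>e. e \<in> arcs G \<Longrightarrow> gain (\<lambda>i x. x e) \<beta> \<le> 0"
      using mem by (auto simp: K_def)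
    \<comment> \<open>Large enough that, after division by \<open>B\<close>, the deviations of each
      player weigh at most 1; the summand 1 keeps \<open>B\<close> positive even if all weights
      vanish.\<close>
    define B where "B = 1 + (\<Sum>i\<in>verts G. \<Sum>x\<in>trade_vectors G i. \<beta> i x)"
    have total_le: "(\<Sum>x\<in>trade_vectors G i. \<beta> i x) \<le> B" if "i \<in> verts G" for i
    proof -
      have "(\<Sum>x\<in>trade_vectors G i. \<beta> i x) \<le> (\<Sum>i\<in>verts G. \<Sum>x\<in>trade_vectors G i. \<beta> i x)"
        using that \<beta>(1)
        by (intro member_le_sum[where f = "\<lambda>i. \<Sum>x\<in>trade_vectors G i. \<beta> i x"])
          (auto simp: nonneg_def sum_nonneg)
      then show ?thesis by (simp add: B_def)
    qed
    have "0 < B"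
      using \<beta>(1) unfolding B_def nonneg_def by (intro add_pos_nonneg sum_nonneg) auto
    \<comment> \<open>Each player deviates with weights \<open>\<beta> i x / B\<close> and puts the
      remaining mass on \<open>\<xi> i\<close>.\<close>
    define \<alpha> where "\<alpha> i x =
      (\<beta> i x + (B - (\<Sum>y\<in>trade_vectors G i. \<beta> i y)) * of_bool (x = \<xi> i)) / B" for i x
    have sum_\<alpha>: "(\<Sum>x\<in>trade_vectors G i. \<alpha> i x * f x) =
        f (\<xi> i) + (\<Sum>x\<in>trade_vectors G i. \<beta> i x * (f x - f (\<xi> i))) / B"
      if "i \<in> verts G" for i and f :: "('b \<Rightarrow> real) \<Rightarrow> real"
    proof -
      let ?X = "trade_vectors G i"
      have "(\<Sum>x\<in>?X. \<alpha> i x * f x) =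
          (\<Sum>x\<in>?X. (\<beta> i x * f x + (B - sum (\<beta> i) ?X) * (of_bool (x = \<xi> i) * f x)) / B)"
        by (simp add: \<alpha>_def algebra_simps)
      also have "\<dots> = ((\<Sum>x\<in>?X. \<beta> i x * f x) + (B - sum (\<beta> i) ?X) * f (\<xi> i)) / B"
        using \<xi>[OF that]
        by (simp add: sum_divide_distrib[symmetric] sum.distrib sum_distrib_left[symmetric]
            sum_point_weight)
      also have "\<dots> = f (\<xi> i) + (\<Sum>x\<in>?X. \<beta> i x * (f x - f (\<xi> i))) / B"
        using \<open>0 < B\<close>
        by (simp add: right_diff_distrib sum_subtractf sum_distrib_right[symmetric] field_simps)
      finally show ?thesis .
    qed
    \<comment> \<open>Taking the entry at \<open>e\<close> for \<open>f\<close> shows that the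
      excess stays nonpositive; taking \<open>v\<close> shows that the objective strictly increases,
      against optimality.\<close>
    have total_\<alpha>: "(\<Sum>i\<in>verts G. \<Sum>x\<in>trade_vectors G i. \<alpha> i x * f i x) =
        (\<Sum>i\<in>verts G. f i (\<xi> i)) + gain f \<beta> / B" for f
      by (simp add: sum_\<alpha> sum.distrib gain_def sum_divide_distrib)
    have "\<alpha> i \<in> weights G i" if "i \<in> verts G" for i
      using \<beta>(1) total_le[OF that] \<open>0 < B\<close> that sum_\<alpha>[OF that, of "\<lambda>_. 1"]
      by (auto simp: weights_def \<alpha>_def nonneg_def)
    moreover have "excess G \<alpha> e \<le> 0" if "e \<in> arcs G" for e
      using \<beta>(3)[OF that] \<open>0 < B\<close> total_\<alpha>[of "\<lambda>i x. x e"] no_excess[OF that]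
      by (simp add: excess_def divide_nonpos_pos)
    ultimately have "lp_objective G wbar \<alpha> \<le> (\<Sum>i\<in>verts G. v i (\<xi> i))"
      using optimal by (auto simp: lp_feasible_def v_def)
    moreover have "lp_objective G wbar \<alpha> = (\<Sum>i\<in>verts G. v i (\<xi> i)) + gain v \<beta> / B"
      using total_\<alpha>[of v] by (simp add: lp_objective_def v_def mult.commute)
    ultimately show False
      using \<beta>(2) \<open>0 < B\<close> by (simp add: divide_le_0_iff)
  qed
  ultimately obtain p where p: "\<And>a c. (a, c) \<in> R \<Longrightarrow> c \<le> (\<Sum>e\<in>arcs G. p e * a e)"
    using farkas_cone[OF finite_arcs, of R K] by blast
  show ?thesis
  proof
    fix e assume "e \<in> arcs G"
    then have "(\<lambda>e'. of_bool (e' = e), 0) \<in> R" by (auto simp: R_def)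
    then have "0 \<le> (\<Sum>e'\<in>arcs G. p e' * of_bool (e' = e))" by (rule p)
    also have "\<dots> = (\<Sum>e'\<in>arcs G. if e' = e then p e' else 0)"
      by (intro sum.cong) auto
    finally show "0 \<le> p e" using \<open>e \<in> arcs G\<close> by simp
  next
    fix i x assume "i \<in> verts G" "x \<in> trade_vectors G i"
    then have "(\<lambda>e. x e - \<xi> i e, v i x - v i (\<xi> i)) \<in> R" by (force simp: R_def)
    then have "v i x - v i (\<xi> i) \<le> (\<Sum>e\<in>arcs G. p e * (x e - \<xi> i e))" by (rule p)
    then show "trade_value G wbar i x - (\<Sum>e\<in>arcs G. p e * x e) \<le>
        trade_value G wbar i (\<xi> i) - (\<Sum>e\<in>arcs G. p e * \<xi> i e)"
      by (simp add: v_def right_diff_distrib sum_subtractf)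
  qed
qed

section \<open>From integral solutions back to equilibria\<close>

text \<open>Only the two endpoints of a trade can have a nonzero entry there, so zero excess makes
  these entries opposite: seller and buyer agree on whether the trade takes place. The buyers'
  entries therefore determine all vectors.\<close>

lemma trade_vectors_eq_trade_vector:
  assumes \<xi>: "\<And>i. i \<in> verts G \<Longrightarrow> \<xi> i \<in> trade_vectors G i"
    and no_excess: "\<And>e. e \<in> arcs G \<Longrightarrow> (\<Sum>i\<in>verts G. \<xi> i e) = 0"
    and i: "i \<in> verts G"
  shows "\<xi> i = trade_vector G i {e \<in> arcs G. \<xi> (head G e) e = 1}"
proof
  fix e
  have balance: "\<xi> (tail G e) e + \<xi> (head G e) e = 0" if "e \<in> arcs G"
    using no_excess[OF that] sum_over_endpoints[OF that, of "\<lambda>i. \<xi> i e"] \<xi>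
    by (auto simp: trade_vectors_def incident_arcs_def)
  consider "e \<in> out_arcs G i" | "e \<in> in_arcs G i" | "e \<notin> incident_arcs G i"
    by (auto simp: incident_arcs_def)
  then show "\<xi> i e = trade_vector G i {e \<in> arcs G. \<xi> (head G e) e = 1} e"
  proof cases
    case 1
    then have "\<xi> i e \<in> {-1, 0}" "\<xi> (head G e) e = - \<xi> i e"
      using \<xi>[OF i] balance by (auto simp: trade_vectors_def)
    then show ?thesis
      using 1 out_in_arcs_disjoint[OF 1] by (auto simp: trade_vector_def)
  next
    case 2
    then have "\<xi> i e \<in> {0, 1}"
      using \<xi>[OF i] by (simp add: trade_vectors_def)
    then show ?thesis
      using 2 out_in_arcs_disjoint[of e i] by (auto simp: trade_vector_def)
  next
    case 3
    then show ?thesis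
      using \<xi>[OF i] by (auto simp: trade_vectors_def trade_vector_def incident_arcs_def)
  qed
qed

lemma equilibrium_of_integral_solution:
  assumes optimal: "lp_optimal G wbar \<alpha>"
    and integral: "integral_weights G \<alpha>"
    and no_excess: "\<forall>e\<in>arcs G. excess G \<alpha> e = 0"
  shows "\<exists>S p. competitive_equilibrium G wbar S p"
proof -
  have weights: "\<alpha> i \<in> weights G i" if "i \<in> verts G" for i
    using optimal that by (auto simp: lp_optimal_def is_arg_max_def lp_feasible_def)
  \<comment> \<open>Integrality selects a single vector per player; fractional weights would not
    describe an actual set of trades.\<close>
  have "\<exists>y\<in>trade_vectors G i. \<forall>x\<in>trade_vectors G i. \<alpha> i x = of_bool (x = y)"
    if "i \<in> verts G" for i
    using weights[OF that] integral that
    by (intro integral_weights_concentrated)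
      (auto simp: weights_def integral_weights_def finite_trade_vectors)
  then obtain \<xi> where \<xi>: "\<And>i. i \<in> verts G \<Longrightarrow> \<xi> i \<in> trade_vectors G i"
    and \<alpha>: "\<And>i x. i \<in> verts G \<Longrightarrow> x \<in> trade_vectors G i \<Longrightarrow> \<alpha> i x = of_bool (x = \<xi> i)"
    by metis
  have \<xi>_balance: "(\<Sum>i\<in>verts G. \<xi> i e) = 0" if "e \<in> arcs G" for e
  proof -
    have "excess G \<alpha> e = excess G (\<lambda>i x. of_bool (x = \<xi> i)) e"
      using \<alpha> by (simp add: excess_def)
    then show ?thesis using no_excess that \<xi> by (simp add: excess_point_weights)
  qed
  have "lp_objective G wbar \<alpha> = lp_objective G wbar (\<lambda>i x. of_bool (x = \<xi> i))"
    using \<alpha> by (simp add: lp_objective_def)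
  then have "lp_objective G wbar \<beta> \<le> (\<Sum>i\<in>verts G. trade_value G wbar i (\<xi> i))"
    if "lp_feasible G \<beta>" for \<beta>
    using optimal that \<xi> by (simp add: lp_optimal_def is_arg_max_linorder lp_objective_point_weights)
  then obtain p where p: "\<And>e. e \<in> arcs G \<Longrightarrow> 0 \<le> p e"
    "\<And>i x. i \<in> verts G \<Longrightarrow> x \<in> trade_vectors G i \<Longrightarrow>
      trade_value G wbar i x - (\<Sum>e\<in>arcs G. p e * x e) \<le>
      trade_value G wbar i (\<xi> i) - (\<Sum>e\<in>arcs G. p e * \<xi> i e)"
    using supporting_prices[OF \<xi> \<xi>_balance] by blast
  define S where "S = {e \<in> arcs G. \<xi> (head G e) e = 1}"
  have "\<xi> i = trade_vector G i S" if "i \<in> verts G" for i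
    unfolding S_def using \<xi> \<xi>_balance that by (rule trade_vectors_eq_trade_vector)
  with p have "competitive_equilibrium G wbar S p"
    by (auto simp: competitive_equilibrium_def is_arg_max_linorder utility_eq_trade_vector
        trade_vector_in_trade_vectors S_def)
  then show ?thesis by blast
qed

end

theorem corollary8p2:
  fixes G :: "('a, 'b) pre_digraph" and wbar :: "'a \<Rightarrow> 'b set \<Rightarrow> real"
  assumes "trading_network G wbar"
  shows "(\<exists>S p. competitive_equilibrium G wbar S p) \<longleftrightarrow>
         (\<exists>\<alpha>. lp_optimal G wbar \<alpha> \<and> integral_weights G \<alpha> \<and> (\<forall>e\<in>arcs G. excess G \<alpha> e = 0))"
proof -
  interpret trading_network G wbar by (fact assms)
  show ?thesis
    using integral_solution_of_equilibrium equilibrium_of_integral_solution by blast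
qed

end
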